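(* For all integers $n\ge 0$ and $k\ge 1$, $$\widehat{Ch}_n^{(k)}(x)=\sum_{\ell=0}^n\sum_{m=0}^{n-\ell}(-1)^\ell\binom{n}{\ell}\,s_1(n-\ell,m)\,B_m^{(\ell)}\,E_\ell^{(k)}(-x).$$
   Context: All generating functions are identities of formal power series in $t$, with $x$ an indeterminate, and $(1+t)^x=\sum_{j\ge0}\binom{x}{j}t^j$ with $\binom{x}{j}=\frac{x(x-1)\cdots(x-j+1)}{j!}$. The Changhee polynomials of the second kind with order $k$ are defined by $\sum_{n=0}^\infty \widehat{Ch}_n^{(k)}(x)\frac{t^n}{n!}=\left(\frac{2}{2+t}\right)^k(1+t)^{x+k}$. The Euler polynomials of order $k$ are defined by $\sum_{n=0}^\infty E_n^{(k)}(x)\frac{t^n}{n!}=\left(\frac{2}{e^t+1}\right)^k e^{xt}$. The Bernoulli numbers of order $\ell$ (for integers $\ell\ge 0$) are defined by $\sum_{n=0}^\infty B_n^{(\ell)}\frac{t^n}{n!}=\left(\frac{t}{e^t-1}\right)^{\ell}$. The (signed) Stirling numbers of the first kind $s_1(n,l)$ are defined by $\prod_{i=0}^{n-1}(x-i)=\sum_{l=0}^n s_1(n,l)x^l$, with $s_1(n,l)=0$ for $l>n$. *)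

theory Defs
  imports "HOL-Computational_Algebra.Computational_Algebra"
begin

text \<open>The indeterminate \<open>x\<close> is \<open>[:0, 1:]\<close>, and generating functions that involve \<open>x\<close>
  live in \<open>K[x][[t]]\<close>, i.e. \<open>'a poly fps\<close>. Division of power series is only available
  over fields, so factors free of \<open>x\<close> are formed in \<open>K[[t]]\<close> and embedded coefficientwise.\<close>

definition fps_lift :: "'a::field_char_0 fps \<Rightarrow> 'a poly fps" where
  "fps_lift f = Abs_fps (\<lambda>n. [:fps_nth f n:])"

text \<open>\<open>(1 + t)\<^sup>p\<close> for a polynomial exponent \<open>p\<close>. The library's \<open>gchoose\<close> and
  \<open>fps_binomial\<close> are typed over fields, which excludes \<open>K[x]\<close>, so the binomial coefficient
  \<open>p (p - 1) \<dots> (p - j + 1) / j!\<close> is written out.\<close>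

definition binomial_series :: "'a::field_char_0 poly \<Rightarrow> 'a poly fps" where
  "binomial_series p = Abs_fps (\<lambda>j. smult (1 / fact j) (\<Prod>i<j. p - of_nat i))"

text \<open>\<open>exp (p t)\<close> for a polynomial \<open>p\<close>.\<close>

definition exp_series :: "'a::field_char_0 poly \<Rightarrow> 'a poly fps" where
  "exp_series p = Abs_fps (\<lambda>j. smult (1 / fact j) (p ^ j))"

definition changhee2_gf :: "nat \<Rightarrow> 'a::field_char_0 poly fps" where
  "changhee2_gf k = fps_lift ((2 / (2 + fps_X)) ^ k) * binomial_series ([:0, 1:] + of_nat k)"

definition changhee2 :: "nat \<Rightarrow> nat \<Rightarrow> 'a::field_char_0 poly" where
  "changhee2 k n = smult (fact n) (fps_nth (changhee2_gf k) n)"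

definition euler_gf :: "nat \<Rightarrow> 'a::field_char_0 poly fps" where
  "euler_gf k = fps_lift ((2 / (fps_exp 1 + 1)) ^ k) * exp_series [:0, 1:]"

definition euler_poly :: "nat \<Rightarrow> nat \<Rightarrow> 'a::field_char_0 poly" where
  "euler_poly k n = smult (fact n) (fps_nth (euler_gf k) n)"

text \<open>Here the denominator \<open>exp t - 1\<close> is not a unit; the division of power series
  cancels the common factor \<open>t\<close>.\<close>

definition bernoulli_ord :: "nat \<Rightarrow> nat \<Rightarrow> 'a::field_char_0" where
  "bernoulli_ord l n = fact n * fps_nth ((fps_X / (fps_exp 1 - 1)) ^ l) n"

definition stirling1_signed :: "nat \<Rightarrow> nat \<Rightarrow> int" where
  "stirling1_signed n l = coeff (\<Prod>i<n. [:0, 1:] - of_nat i) l"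

text \<open>The defining expansions, with \<open>f\<^sub>n / n!\<close> as coefficient of \<open>t\<^sup>n\<close>.\<close>

lemma changhee2_egf:
  "Abs_fps (\<lambda>n. smult (1 / fact n) (changhee2 k n)) = changhee2_gf k"
  by (simp add: fps_eq_iff changhee2_def)

lemma euler_poly_egf:
  "Abs_fps (\<lambda>n. smult (1 / fact n) (euler_poly k n)) = euler_gf k"
  by (simp add: fps_eq_iff euler_poly_def)

lemma bernoulli_ord_egf:
  "Abs_fps (\<lambda>n. bernoulli_ord l n / fact n) = (fps_X / (fps_exp 1 - 1)) ^ l"
  by (simp add: fps_eq_iff bernoulli_ord_def)

text \<open>Specialising \<open>x\<close> to a scalar recovers the library's series.\<close>

lemma poly_binomial_series:
  "Abs_fps (\<lambda>j. poly (fps_nth (binomial_series p) j) a) = fps_binomial (poly p a)"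
  by (simp add: fps_eq_iff binomial_series_def poly_prod gbinomial_prod_rev atLeast0LessThan)

lemma poly_exp_series:
  "Abs_fps (\<lambda>j. poly (fps_nth (exp_series p) j) a) = fps_exp (poly p a)"
  by (simp add: fps_eq_iff exp_series_def)

end

theory Submission
  imports Defs
begin

text \<open>
  Write \<open>u = log (1 + t)\<close>. Since \<open>1 + t = exp u\<close>, dividing numerator and denominator of
  \<open>2 / (2 + t)\<close> by \<open>exp u\<close> turns the Changhee generating function into an Euler one:
  \<open>(2 / (2 + t))^k (1 + t)^(x + k) = (2 / (exp (-u) + 1))^k exp (x u)\<close>, which is
  \<open>\<Sum>l. E\<^sub>l(-x) (-u)^l / l!\<close> (lemma \<open>changhee_series_eq_euler_compose\<close>).
  It remains to expand the powers \<open>u^l\<close>. Because \<open>t / (exp t - 1)\<close> becomes \<open>u / t\<close>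
  under the substitution \<open>t := u\<close>, the series \<open>(u / t)^l\<close> is the order \<open>l\<close>
  Bernoulli generating function evaluated at \<open>u\<close>; and as \<open>u^m / m!\<close> is the exponential
  generating function of the numbers \<open>s\<^sub>1(j, m)\<close>, the coefficients of \<open>u^l\<close>
  are \<open>\<Sum>m. s\<^sub>1(j, m) B\<^sub>m\<close> up to factorials, at index shifted by \<open>l\<close>
  (lemma \<open>fps_ln_power_nth\<close>).

  The computation takes place over the field of scalars, where division and composition of
  power series are at hand: both sides are polynomials in \<open>x\<close> over an infinite field, so it
  is enough to compare their values at every scalar \<open>a\<close>.
\<close>

section \<open>Composition with the logarithm\<close>

lemma fps_exp_compose_ln: "fps_exp c oo fps_ln 1 = fps_binomial (c::'a::field_char_0)"
proof -
  have "fps_deriv (fps_exp c oo fps_ln 1) =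
      fps_const c * (fps_exp c oo fps_ln 1) / (1 + fps_X)"
    by (simp add: fps_compose_deriv fps_ln_deriv fps_compose_mult_distrib fps_divide_unit)
  then have "fps_exp c oo fps_ln 1 =
      fps_const ((fps_exp c oo fps_ln 1) $ 0) * fps_binomial c"
    by (simp only: fps_binomial_ODE_unique)
  then show ?thesis
    by simp
qed

lemma fps_exp_compose_neg_ln: "fps_exp c oo (- fps_ln 1) = fps_binomial (- c::'a::field_char_0)"
proof -
  have "fps_exp c oo (- fps_ln 1) = fps_exp c oo (- fps_X oo fps_ln 1)"
    by (simp add: fps_compose_uminus)
  also have "\<dots> = (fps_exp c oo - fps_X) oo fps_ln 1"
    by (rule fps_compose_assoc) simp_all
  also have "\<dots> = fps_binomial (- c)"
    by (simp add: fps_exp_compose_ln)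
  finally show ?thesis .
qed

section \<open>Stirling numbers and powers of the logarithm\<close>

lemma of_int_stirling1_signed:
  "of_int (stirling1_signed n l) = coeff (\<Prod>i<n. [:0, 1:] - of_nat i :: 'a::comm_ring_1 poly) l"
  unfolding stirling1_signed_def
proof (induction n arbitrary: l)
  case 0
  then show ?case by (simp add: coeff_1)
next
  case (Suc n)
  have expand: "p * ([:0, 1:] - of_nat n) = pCons 0 p - smult (of_nat n) p" for p :: "'b::comm_ring_1 poly"
    by (simp add: algebra_simps of_nat_poly)
  show ?case
    by (simp only: prod.lessThan_Suc expand coeff_diff coeff_smult coeff_pCons)
       (simp add: Suc.IH split: nat.split)
qed

text \<open>Comparing the two expansions \<open>\<Sum>m. a^m u^m / m! = (1 + t)^a = \<Sum>j. (a choose j) t^j\<close>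
  at \<open>t^j\<close> gives two polynomials in \<open>a\<close> that agree at every scalar, hence have
  the same coefficients.\<close>

lemma fps_ln_power_nth_stirling:
  "(fps_ln 1 ^ m) $ j = (fact m / fact j * of_int (stirling1_signed j m) :: 'a::field_char_0)"
proof -
  define p :: "'a poly" where
    "p = (\<Sum>i=0..j. monom ((fps_ln 1 ^ i) $ j / fact i) i)"
  define q :: "'a poly" where
    "q = smult (1 / fact j) (\<Prod>i<j. [:0, 1:] - of_nat i)"
  have "poly p a = poly q a" for a
  proof -
    have "poly p a = (fps_exp a oo fps_ln 1) $ j"
      by (simp add: p_def poly_sum poly_monom fps_compose_nth mult_ac)
    also have "\<dots> = poly q a"
      by (simp add: fps_exp_compose_ln q_def poly_prod gbinomial_prod_rev atLeast0LessThan)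
    finally show ?thesis .
  qed
  then have "p = q"
    by (intro poly_eq_poly_eq_iff[THEN iffD1] ext)
  then have eq: "coeff p m = of_int (stirling1_signed j m) / fact j"
    by (simp add: q_def of_int_stirling1_signed)
  show ?thesis
  proof (cases "m \<le> j")
    case True
    then have "coeff p m = (fps_ln 1 ^ m) $ j / fact m"
      by (simp add: p_def coeff_sum)
    with eq show ?thesis by (simp add: field_simps)
  next
    case False
    then have "coeff p m = 0"
      by (simp add: p_def coeff_sum)
    moreover have "(fps_ln 1 ^ m :: 'a fps) $ j = 0"
      using False by (simp add: startsby_zero_power_prefix)
    ultimately show ?thesis using eq by simp
  qed
qed

lemma fps_compose_ln_nth:
  "(f oo fps_ln 1) $ j =
    (\<Sum>m=0..j. of_int (stirling1_signed j m) * (fact m * f $ m)) / (fact j :: 'a::field_char_0)"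
  by (simp add: fps_compose_nth fps_ln_power_nth_stirling sum_divide_distrib mult_ac)

section \<open>Bernoulli numbers and powers of the logarithm\<close>

text \<open>Stated as a product, the substitution \<open>t := u\<close> in \<open>t / (exp t - 1)\<close> needs no
  division by the non-unit \<open>t\<close>.\<close>

lemma bernoulli_compose_ln:
  "((fps_X / (fps_exp 1 - 1)) ^ l oo fps_ln 1) * fps_X ^ l = (fps_ln 1 ^ l :: 'a::field_char_0 fps)"
proof -
  have "subdegree (fps_exp 1 - 1 :: 'a fps) = 1"
    by (intro subdegreeI) auto
  then have "fps_exp 1 - 1 dvd (fps_X :: 'a fps)"
    by (subst fps_dvd_iff) auto
  from fps_compose_divide[OF this, of "fps_ln 1"]
  have "fps_ln 1 = ((fps_X / (fps_exp 1 - 1)) oo fps_ln 1) * (fps_X :: 'a fps)"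
    by (simp add: fps_compose_sub_distrib fps_exp_compose_ln fps_binomial_1)
  from arg_cong[OF this, of "\<lambda>f. f ^ l"] show ?thesis
    by (simp add: power_mult_distrib fps_compose_power)
qed

lemma fps_ln_power_nth:
  assumes "l \<le> n"
  shows "(fps_ln 1 ^ l) $ n =
    (\<Sum>m=0..n - l. of_int (stirling1_signed (n - l) m) * bernoulli_ord l m)
      / (fact (n - l) :: 'a::field_char_0)"
proof -
  have "(fps_ln 1 ^ l :: 'a fps) $ n = ((fps_X / (fps_exp 1 - 1)) ^ l oo fps_ln 1) $ (n - l)"
    using assms by (subst bernoulli_compose_ln [symmetric]) (simp add: fps_X_power_mult_right_nth)
  then show ?thesis
    by (simp only: fps_compose_ln_nth bernoulli_ord_def)
qed

section \<open>The Changhee series as an Euler series\<close>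

text \<open>The factor \<open>(1 + t)^k\<close> in the definition of the second kind polynomials is exactly what
  \<open>2 / (exp (-u) + 1) = 2 (1 + t) / (2 + t)\<close> produces.\<close>

lemma changhee_series_eq_euler_compose:
  fixes a :: "'a::field_char_0"
  shows "(2 / (2 + fps_X)) ^ k * fps_binomial (a + of_nat k) =
    (2 / (fps_exp 1 + 1)) ^ k * fps_exp (- a) oo (- fps_ln 1)"
proof -
  define v :: "'a fps" where "v = - fps_ln 1"
  have v0: "v $ 0 = 0"
    by (simp add: v_def)
  define H :: "'a fps" where "H = 2 / (fps_exp 1 + 1)"
  define D :: "'a fps" where "D = fps_binomial (- 1) + 1"
  have unit: "(2 + fps_X :: 'a fps) \<noteq> 0" "(2 + fps_X :: 'a fps) $ 0 \<noteq> 0"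
    by (auto simp: fps_eq_iff intro!: exI[of _ 0])
  have unitE: "(fps_exp 1 + 1 :: 'a fps) $ 0 \<noteq> 0"
    by simp
  have "H * (fps_exp 1 + 1) = 2"
    unfolding H_def using unitE by (simp add: fps_divide_unit mult.assoc inverse_mult_eq_1)
  then have "(H * (fps_exp 1 + 1)) oo v = 2 oo v"
    by simp
  moreover have "(2::'a fps) oo v = 2"
    by (metis fps_const_compose numeral_fps_const)
  ultimately have HD: "(H oo v) * D = 2"
    using v0
    by (simp add: fps_compose_mult_distrib fps_compose_add_distrib v_def fps_exp_compose_neg_ln D_def)
  have "D * fps_binomial 1 = 2 + fps_X"
    using fps_binomial_add_mult[of "- 1" "1::'a"]
    by (simp add: D_def distrib_right[of _ 1] fps_binomial_1)
  then have "(H oo v) * (2 + fps_X) = (H oo v) * D * fps_binomial 1"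
    by (simp add: mult.assoc)
  also have "\<dots> = 2 * fps_binomial 1"
    by (simp add: HD)
  also have "\<dots> = (2 / (2 + fps_X) * fps_binomial 1) * (2 + fps_X)"
    using unit(2) by (simp add: fps_divide_unit mult_ac inverse_mult_eq_1')
  finally have H: "H oo v = 2 / (2 + fps_X) * fps_binomial 1"
    using unit(1) by (simp only: mult_cancel_right) simp
  have "H ^ k * fps_exp (- a) oo v = (H oo v) ^ k * (fps_exp (- a) oo v)"
    using v0 by (simp add: fps_compose_mult_distrib fps_compose_power)
  also have "\<dots> = (2 / (2 + fps_X)) ^ k * (fps_binomial (of_nat k) * fps_binomial a)"
    unfolding H by (simp add: power_mult_distrib fps_binomial_power v_def fps_exp_compose_neg_ln)
  also have "fps_binomial (of_nat k) * fps_binomial a = fps_binomial (a + of_nat k)"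
    by (simp add: add.commute flip: fps_binomial_add_mult)
  finally show ?thesis
    by (simp add: H_def v_def)
qed

section \<open>Specialising the indeterminate\<close>

lemma poly_fps_lift_mult_nth:
  "poly ((fps_lift f * g) $ n) a = (f * Abs_fps (\<lambda>j. poly (g $ j) a)) $ n"
  by (simp add: fps_lift_def fps_mult_nth poly_sum)

lemma poly_changhee2:
  "poly (changhee2 k n) a =
    fact n * ((2 / (2 + fps_X)) ^ k * fps_binomial (a + of_nat k)) $ n"
  by (simp add: changhee2_def changhee2_gf_def poly_fps_lift_mult_nth poly_binomial_series)

lemma poly_euler_poly:
  "poly (euler_poly k l) a = fact l * ((2 / (fps_exp 1 + 1)) ^ k * fps_exp a) $ l"
  by (simp add: euler_poly_def euler_gf_def poly_fps_lift_mult_nth poly_exp_series)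

theorem mainTheorem7:
  fixes n k :: nat
  assumes "k \<ge> 1"
  shows "(changhee2 k n :: 'a::field_char_0 poly) =
    (\<Sum>l = 0..n. \<Sum>m = 0..n - l.
      smult ((-1) ^ l * of_nat (n choose l) * of_int (stirling1_signed (n - l) m)
             * bernoulli_ord l m)
        (pcompose (euler_poly k l) (- [:0, 1:])))" (is "_ = ?rhs")
proof -
  have "poly (changhee2 k n) a = poly ?rhs a" for a :: 'a
  proof -
    let ?S = "\<lambda>l. \<Sum>m=0..n - l. of_int (stirling1_signed (n - l) m) * (bernoulli_ord l m :: 'a)"
    have "poly (changhee2 k n) a =
        fact n * ((2 / (fps_exp 1 + 1)) ^ k * fps_exp (- a) oo (- fps_ln 1)) $ n"
      by (simp only: poly_changhee2 changhee_series_eq_euler_compose)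
    also have "\<dots> = (\<Sum>l=0..n. fact n * (poly (euler_poly k l) (- a) / fact l
        * ((- 1) ^ l * (fps_ln 1 ^ l) $ n)))"
      unfolding fps_compose_nth sum_distrib_left
    proof (rule sum.cong)
      fix l
      have "(- fps_ln 1 :: 'a fps) ^ l = fps_const ((- 1) ^ l) * fps_ln 1 ^ l"
        by (subst power_minus) (simp flip: fps_const_power fps_const_neg)
      then show "fact n * (((2 / (fps_exp 1 + 1)) ^ k * fps_exp (- a)) $ l * ((- fps_ln 1) ^ l) $ n)
          = fact n * (poly (euler_poly k l) (- a) / fact l * ((- 1) ^ l * (fps_ln 1 ^ l) $ n))"
        by (simp add: poly_euler_poly)
    qed simp
    also have "\<dots> = (\<Sum>l=0..n. (- 1) ^ l * of_nat (n choose l) * ?S l * poly (euler_poly k l) (- a))"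
    proof (rule sum.cong)
      fix l assume "l \<in> {0..n}"
      then have l: "l \<le> n" by simp
      show "fact n * (poly (euler_poly k l) (- a) / fact l * ((- 1) ^ l * (fps_ln 1 ^ l) $ n))
          = (- 1) ^ l * of_nat (n choose l) * ?S l * poly (euler_poly k l) (- a)"
        by (simp add: fps_ln_power_nth[OF l] binomial_fact[OF l])
    qed simp
    also have "\<dots> = poly ?rhs a"
      by (simp add: poly_sum poly_pcompose sum_distrib_left sum_distrib_right mult.assoc)
    finally show ?thesis .
  qed
  then show ?thesis
    by (intro poly_eq_poly_eq_iff[THEN iffD1] ext)
qed

end
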